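(* Let $R$ be a (commutative, zero-sum-free) semifield and let $G$ be a finite group. Then the simplicial sets $D_R(NG)$ and $D_R(\Delta_G)$ are compositories, i.e. each can be equipped with composition operations satisfying the axioms of a compository.
   Context: A semifield is a commutative semiring with $0\ne1$ in which every non-zero element has a multiplicative inverse; zero-sum-free means $a+b=0$ implies $a=b=0$. For a set $S$, $D_R(S)$ is the set of finitely supported functions $p:S\to R$ with $\sum_s p(s)=1$, functorial by pushforward $D_R(f)(p)(s')=\sum_{f(s)=s'}p(s)$; for a simplicial set $Y$, $D_R(Y)$ is obtained by applying $D_R$ degreewise. $NG$ is the nerve of $G$. For a set $U$, $\Delta_U$ is the simplicial set with $(\Delta_U)_n=U^{n+1}$, $d_i$ deleting the $i$-th entry and $s_j$ repeating the $j$-th entry. For $k\le n$ let $S^k:[k]\to[n]$, $S^k(i)=i$, and $T^k:[k]\to[n]$, $T^k(i)=i+n-k$; for a simplicial set $Z$ write $S_k=(S^k)^*,T_k=(T^k)^*:Z_n\to Z_k$. A pair $(x,y)\in Z_m\times Z_n$ is $k$-composable ($0\le k\le \min(m,n)$) if $T_k(x)=S_k(y)$. A compository is a simplicial set $Z$ with, for every $k\in\mathbb{N}$ and every $k$-composable pair $(x,y)\in Z_m\times Z_n$, a composition $x\circ_k y\in Z_{m+n-k}$ such that: (a) Identity: if $k=n$ then $x\circ_n y=x$; if $k=m$ then $x\circ_m y=y$. (b) Back-and-forth: if $(x,y)\in Z_m\times Z_n$ is $k$-composable and $z=x\circ_k y\in Z_j$, $j=m+n-k$, then for every $\tilde m$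 with $m\le \tilde m\le j$, $S_{\tilde m}(z)\circ_{\tilde m+n-j}y=z$ whenever $\tilde m+n-j\le n$, and for every $\tilde n$ with $n\le\tilde n\le j$, $x\circ_{m+\tilde n-j}T_{\tilde n}(z)=z$. (That these pairs are composable is part of the assertion.) (c) Partial naturality: if $(x,y)\in Z_m\times Z_n$ is $k$-composable and $f:[m']\to[m]$, $g:[n']\to[n]$ are order-preserving maps with $f\circ T^k=T^k$ and $g\circ S^k=S^k$ (where $k\le m',n'$), then $f^*(x)\circ_k g^*(y)=h^*(x\circ_k y)$, where $h:[m'+n'-k]\to[m+n-k]$ is the order-preserving map obtained by gluing $f$ and $g$ along the common $[k]$, that is $h\circ S^{m'}=S^{m}\circ f$ and $h\circ T^{n'}=T^{n}\circ g$ (such an $h$ is required to be order preserving). *)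

theory Defs
  imports "HOL-Algebra.Group"
begin

section \<open>Semifields\<close>

class semifield = comm_semiring_1 +
  assumes ex_mult_inverse: "a \<noteq> 0 \<Longrightarrow> \<exists>b. a * b = 1"

class zero_sum_free_semifield = semifield +
  assumes zero_sum_free: "a + b = 0 \<Longrightarrow> a = 0 \<and> b = 0"


section \<open>Simplicial sets\<close>

text \<open>
  The ordinal \<open>[n]\<close> is \<open>{..n}\<close>. Morphisms \<open>[m] \<rightarrow> [n]\<close> are extensional functions, so that
  equality of morphisms is equality of functions.
\<close>

definition ord_maps :: "nat \<Rightarrow> nat \<Rightarrow> (nat \<Rightarrow> nat) set" where
  "ord_maps m n = {f \<in> {..m} \<rightarrow>\<^sub>E {..n}. mono_on {..m} f}"

text \<open>\<open>pull Z m n f\<close> is \<open>f\<^sup>* : Z\<^sub>n \<rightarrow> Z\<^sub>m\<close> for \<open>f : [m] \<rightarrow> [n]\<close>.\<close>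

record 'a sset =
  simplices :: "nat \<Rightarrow> 'a set"
  pull :: "nat \<Rightarrow> nat \<Rightarrow> (nat \<Rightarrow> nat) \<Rightarrow> 'a \<Rightarrow> 'a"

locale simplicial_set =
  fixes Z :: "'a sset"
  assumes pull_closed:
      "f \<in> ord_maps m n \<Longrightarrow> x \<in> simplices Z n \<Longrightarrow> pull Z m n f x \<in> simplices Z m"
    and pull_id:
      "x \<in> simplices Z n \<Longrightarrow> pull Z n n (\<lambda>i\<in>{..n}. i) x = x"
    and pull_compose:
      "f \<in> ord_maps l m \<Longrightarrow> g \<in> ord_maps m n \<Longrightarrow> x \<in> simplices Z n \<Longrightarrow>
        pull Z l n (compose {..l} g f) x = pull Z l m f (pull Z m n g x)"

definition coface :: "nat \<Rightarrow> nat \<Rightarrow> nat \<Rightarrow> nat" where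
  "coface n i = (\<lambda>j\<in>{..n}. if j < i then j else Suc j)"

definition codegeneracy :: "nat \<Rightarrow> nat \<Rightarrow> nat \<Rightarrow> nat" where
  "codegeneracy n i = (\<lambda>j\<in>{..Suc n}. if j \<le> i then j else j - 1)"


section \<open>Compositories\<close>

text \<open>
  \<open>init_map k\<close> is \<open>S\<^sup>k : [k] \<rightarrow> [n]\<close> for every \<open>n \<ge> k\<close>; \<open>term_map k n\<close> is \<open>T\<^sup>k : [k] \<rightarrow> [n]\<close>.
\<close>

definition init_map :: "nat \<Rightarrow> nat \<Rightarrow> nat" where
  "init_map k = (\<lambda>i\<in>{..k}. i)"

definition term_map :: "nat \<Rightarrow> nat \<Rightarrow> nat \<Rightarrow> nat" where
  "term_map k n = (\<lambda>i\<in>{..k}. i + (n - k))"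

definition initial :: "'a sset \<Rightarrow> nat \<Rightarrow> nat \<Rightarrow> 'a \<Rightarrow> 'a" where
  "initial Z k n = pull Z k n (init_map k)"

definition terminal :: "'a sset \<Rightarrow> nat \<Rightarrow> nat \<Rightarrow> 'a \<Rightarrow> 'a" where
  "terminal Z k n = pull Z k n (term_map k n)"

definition composable :: "'a sset \<Rightarrow> nat \<Rightarrow> nat \<Rightarrow> nat \<Rightarrow> 'a \<Rightarrow> 'a \<Rightarrow> bool" where
  "composable Z m n k x y \<longleftrightarrow>
     x \<in> simplices Z m \<and> y \<in> simplices Z n \<and> k \<le> min m n \<and> terminal Z k m x = initial Z k n y"

text \<open>
  \<open>comp m n k x y\<close> is \<open>x \<circ>\<^sub>k y\<close> for \<open>(x, y) \<in> Z\<^sub>m \<times> Z\<^sub>n\<close>; its values on pairs that are not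
  \<open>k\<close>-composable are irrelevant.
  In \<open>partial_natural\<close>, the hypotheses imply that \<open>(f\<^sup>* x, g\<^sup>* y)\<close> is \<open>k\<close>-composable, and the
  order-preserving \<open>h\<close> exists and is unique (\<open>ex1_glue\<close> below).
\<close>

locale compository = simplicial_set Z
  for Z :: "'a sset" +
  fixes comp :: "nat \<Rightarrow> nat \<Rightarrow> nat \<Rightarrow> 'a \<Rightarrow> 'a \<Rightarrow> 'a"
  assumes comp_closed:
      "composable Z m n k x y \<Longrightarrow> comp m n k x y \<in> simplices Z (m + n - k)"
    and identity_right:
      "composable Z m n n x y \<Longrightarrow> comp m n n x y = x"
    and identity_left:
      "composable Z m n m x y \<Longrightarrow> comp m n m x y = y"
    and back_and_forth_left:
      "composable Z m n k x y \<Longrightarrow> j = m + n - k \<Longrightarrow> z = comp m n k x y \<Longrightarrow>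
        m \<le> m' \<Longrightarrow> m' \<le> j \<Longrightarrow> m' + n - j \<le> n \<Longrightarrow>
        composable Z m' n (m' + n - j) (initial Z m' j z) y \<and>
        comp m' n (m' + n - j) (initial Z m' j z) y = z"
    and back_and_forth_right:
      "composable Z m n k x y \<Longrightarrow> j = m + n - k \<Longrightarrow> z = comp m n k x y \<Longrightarrow>
        n \<le> n' \<Longrightarrow> n' \<le> j \<Longrightarrow>
        composable Z m n' (m + n' - j) x (terminal Z n' j z) \<and>
        comp m n' (m + n' - j) x (terminal Z n' j z) = z"
    and partial_natural:
      "composable Z m n k x y \<Longrightarrow> k \<le> m' \<Longrightarrow> k \<le> n' \<Longrightarrow>
        f \<in> ord_maps m' m \<Longrightarrow> g \<in> ord_maps n' n \<Longrightarrow>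
        compose {..k} f (term_map k m') = term_map k m \<Longrightarrow>
        compose {..k} g (init_map k) = init_map k \<Longrightarrow>
        h \<in> ord_maps (m' + n' - k) (m + n - k) \<Longrightarrow>
        compose {..m'} h (init_map m') = compose {..m'} (init_map m) f \<Longrightarrow>
        compose {..n'} h (term_map n' (m' + n' - k)) = compose {..n'} (term_map n (m + n - k)) g \<Longrightarrow>
        comp m' n' k (pull Z m' m f x) (pull Z n' n g y) =
          pull Z (m' + n' - k) (m + n - k) h (comp m n k x y)"

lemma ex1_glue:
  assumes "k \<le> m" "k \<le> n" "k \<le> m'" "k \<le> n'"
    and f: "f \<in> ord_maps m' m" and g: "g \<in> ord_maps n' n"
    and fT: "compose {..k} f (term_map k m') = term_map k m"
    and gS: "compose {..k} g (init_map k) = init_map k"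
  shows "\<exists>!h. h \<in> ord_maps (m' + n' - k) (m + n - k) \<and>
    compose {..m'} h (init_map m') = compose {..m'} (init_map m) f \<and>
    compose {..n'} h (term_map n' (m' + n' - k)) = compose {..n'} (term_map n (m + n - k)) g"
proof -
  let ?j = "m' + n' - k"
  have fm: "f i \<le> m" if "i \<le> m'" for i using f that by (auto simp: ord_maps_def PiE_def Pi_def)
  have gm: "g i \<le> n" if "i \<le> n'" for i using g that by (auto simp: ord_maps_def PiE_def Pi_def)
  have fmono: "f a \<le> f b" if "a \<le> b" "b \<le> m'" for a b
    using f that by (auto simp: ord_maps_def intro: mono_onD)
  have gmono: "g a \<le> g b" if "a \<le> b" "b \<le> n'" for a b
    using g that by (auto simp: ord_maps_def intro: mono_onD)
  have f_eq: "f (i + (m' - k)) = i + (m - k)" if "i \<le> k" for i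
    using fun_cong[OF fT, of i] that by (simp add: compose_def term_map_def)
  have g_eq: "g i = i" if "i \<le> k" for i
    using fun_cong[OF gS, of i] that by (simp add: compose_def init_map_def)
  define h where "h = (\<lambda>i\<in>{..?j}. if i \<le> m' then f i else g (i - (m' - k)) + (m - k))"
  have g_ge: "k \<le> g i" if "k \<le> i" "i \<le> n'" for i
    using gmono[OF that] g_eq[of k] by simp
  have h: "h \<in> ord_maps ?j (m + n - k)"
    unfolding ord_maps_def
  proof (intro CollectI conjI mono_onI)
    have "h i \<le> m + n - k" if "i \<le> ?j" for i
    proof (cases "i \<le> m'")
      case True
      then show ?thesis using that fm[OF True] assms(1,2) by (simp add: h_def)
    next
      case False
      have "g (i - (m' - k)) \<le> n" using that assms(3,4) by (intro gm) linarith
      then show ?thesis using that False assms(1,2) by (simp add: h_def)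
    qed
    then show "h \<in> {..?j} \<rightarrow>\<^sub>E {..m + n - k}" by (auto simp: h_def PiE_def extensional_def)
    fix a b assume ab: "a \<in> {..?j}" "b \<in> {..?j}" "a \<le> b"
    consider "b \<le> m'" | "a \<le> m'" "m' < b" | "m' < a" by linarith
    then show "h a \<le> h b"
    proof cases
      case 1
      then show ?thesis using ab fmono[of a b] by (simp add: h_def)
    next
      case 2
      have "k \<le> g (b - (m' - k))" using 2 ab assms(3,4) by (intro g_ge) auto
      then show ?thesis using 2 ab fm[of a] assms(1) by (simp add: h_def)
    next
      case 3
      have "g (a - (m' - k)) \<le> g (b - (m' - k))" using 3 ab assms(3,4) by (intro gmono) auto
      then show ?thesis using 3 ab by (simp add: h_def)
    qed
  qed
  have hS: "compose {..m'} h (init_map m') = compose {..m'} (init_map m) f"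
  proof
    fix i
    have "i \<le> m' \<Longrightarrow> i \<le> ?j" using assms(4) by linarith
    then show "compose {..m'} h (init_map m') i = compose {..m'} (init_map m) f i"
      using fm[of i] by (simp add: compose_def init_map_def h_def)
  qed
  have hT: "compose {..n'} h (term_map n' ?j) = compose {..n'} (term_map n (m + n - k)) g"
  proof
    fix i
    show "compose {..n'} h (term_map n' ?j) i = compose {..n'} (term_map n (m + n - k)) g i"
    proof (cases "i \<le> n'")
      case True
      have e: "?j - n' = m' - k" "m + n - k - n = m - k" using assms(1-4) by auto
      show ?thesis
      proof (cases "i \<le> k")
        case True
        then have "i \<le> n" "i + (m' - k) \<le> m'" "i + (m' - k) \<le> ?j" using True assms(1-4) by auto
        then show ?thesis using \<open>i \<le> n'\<close> f_eq[OF True] g_eq[OF True] e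
          by (simp del: add_diff_assoc add_diff_assoc2 add: compose_def term_map_def h_def)
      next
        case False
        then have "\<not> i + (m' - k) \<le> m'" "i + (m' - k) \<le> ?j" using \<open>i \<le> n'\<close> assms(3,4) by auto
        then show ?thesis using \<open>i \<le> n'\<close> gm[of i] e
          by (simp del: add_diff_assoc add_diff_assoc2 add: compose_def term_map_def h_def)
      qed
    qed (simp add: compose_def)
  qed
  have uniq: "h1 = h2"
    if h1: "h1 \<in> ord_maps ?j (m + n - k)"
        "compose {..m'} h1 (init_map m') = compose {..m'} (init_map m) f"
        "compose {..n'} h1 (term_map n' ?j) = compose {..n'} (term_map n (m + n - k)) g"
      and h2: "h2 \<in> ord_maps ?j (m + n - k)"
        "compose {..m'} h2 (init_map m') = compose {..m'} (init_map m) f"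
        "compose {..n'} h2 (term_map n' ?j) = compose {..n'} (term_map n (m + n - k)) g" for h1 h2
  proof
    fix i
    consider "i \<le> m'" | "m' < i" "i \<le> ?j" | "?j < i" by linarith
    then show "h1 i = h2 i"
    proof cases
      case 1
      then show ?thesis using fun_cong[OF h1(2)[folded h2(2)], of i]
        by (simp add: compose_def init_map_def)
    next
      case 2
      have e: "i - (m' - k) \<le> n'" "i - (m' - k) + (?j - n') = i"
        using 2 assms(3,4) by linarith+
      then show ?thesis using fun_cong[OF h1(3)[folded h2(3)], of "i - (m' - k)"]
        by (simp add: compose_def term_map_def)
    next
      case 3
      then show ?thesis using h1(1) h2(1) by (auto simp: ord_maps_def PiE_def extensional_def)
    qed
  qed
  show ?thesis
  proof (rule ex1I)
    show "h \<in> ord_maps ?j (m + n - k) \<and>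
      compose {..m'} h (init_map m') = compose {..m'} (init_map m) f \<and>
      compose {..n'} h (term_map n' ?j) = compose {..n'} (term_map n (m + n - k)) g"
      using h hS hT by (intro conjI)
  next
    fix h' assume "h' \<in> ord_maps ?j (m + n - k) \<and>
      compose {..m'} h' (init_map m') = compose {..m'} (init_map m) f \<and>
      compose {..n'} h' (term_map n' ?j) = compose {..n'} (term_map n (m + n - k)) g"
    then show "h' = h" by (elim conjE) (rule uniq[OF _ _ _ h hS hT])
  qed
qed


section \<open>The simplicial sets \<open>\<Delta>\<^sub>U\<close> and \<open>NG\<close>\<close>

definition Delta :: "'u set \<Rightarrow> 'u list sset" where
  "Delta U = \<lparr>simplices = (\<lambda>n. {us. length us = Suc n \<and> set us \<subseteq> U}),
              pull = (\<lambda>m n f us. map (\<lambda>i. us ! f i) [0..<Suc m])\<rparr>"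

lemma Delta_face:
  assumes "us \<in> simplices (Delta U) (Suc n)" "i \<le> Suc n"
  shows "pull (Delta U) n (Suc n) (coface n i) us = take i us @ drop (Suc i) us"
  using assms by (intro nth_equalityI) (auto simp del: upt_Suc simp: Delta_def coface_def nth_append)

lemma Delta_degeneracy:
  assumes "us \<in> simplices (Delta U) n" "i \<le> n"
  shows "pull (Delta U) (Suc n) n (codegeneracy n i) us = take i us @ us ! i # drop i us"
proof (rule nth_equalityI)
  have len: "length us = Suc n" using assms(1) by (simp add: Delta_def)
  show "length (pull (Delta U) (Suc n) n (codegeneracy n i) us) =
      length (take i us @ us ! i # drop i us)"
    using len assms(2) by (simp add: Delta_def)
  fix j assume "j < length (pull (Delta U) (Suc n) n (codegeneracy n i) us)"
  then have j: "j < Suc (Suc n)" by (simp add: Delta_def)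
  then have "pull (Delta U) (Suc n) n (codegeneracy n i) us ! j = us ! (if j \<le> i then j else j - 1)"
    by (simp add: Delta_def codegeneracy_def del: upt_Suc)
  also have "\<dots> = (take i us @ us ! i # drop i us) ! j"
  proof (cases j i rule: linorder_cases)
    case greater
    then obtain d where "j = Suc (i + d)" using less_imp_Suc_add by blast
    then show ?thesis using len assms(2) j by (simp add: nth_append)
  qed (use len assms(2) in \<open>simp_all add: nth_append\<close>)
  finally show "pull (Delta U) (Suc n) n (codegeneracy n i) us ! j =
      (take i us @ us ! i # drop i us) ! j" .
qed

text \<open>
  An \<open>n\<close>-simplex of \<open>NG\<close> is \<open>[g\<^sub>1, \<dots>, g\<^sub>n]\<close>, where \<open>g\<^sub>i\<close> sits on the edge from vertex \<open>i - 1\<close> to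
  vertex \<open>i\<close>; the pullback along \<open>f\<close> has entries
  \<open>g\<^bsub>f(i-1)+1\<^esub> \<otimes> \<cdots> \<otimes> g\<^bsub>f(i)\<^esub>\<close>.  List indices start at 0.
\<close>

definition nerve :: "('g, 'b) monoid_scheme \<Rightarrow> 'g list sset" where
  "nerve G = \<lparr>simplices = (\<lambda>n. {gs. length gs = n \<and> set gs \<subseteq> carrier G}),
              pull = (\<lambda>m n f gs.
                map (\<lambda>i. foldr (mult G) (map ((!) gs) [f i..<f (Suc i)]) (one G)) [0..<m])\<rparr>"


section \<open>Distributions\<close>

text \<open>
  Finitely supported functions \<open>S \<rightarrow> R\<close> are represented by functions on the whole type that
  vanish outside \<open>S\<close>.
\<close>

definition distributions :: "'a set \<Rightarrow> ('a \<Rightarrow> 'r::comm_semiring_1) set" where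
  "distributions S = {p. finite {s. p s \<noteq> 0} \<and> {s. p s \<noteq> 0} \<subseteq> S \<and> (\<Sum>s | p s \<noteq> 0. p s) = 1}"

definition dist_map :: "('a \<Rightarrow> 'b) \<Rightarrow> ('a \<Rightarrow> 'r::comm_semiring_1) \<Rightarrow> 'b \<Rightarrow> 'r" where
  "dist_map f p = (\<lambda>t. \<Sum>s | p s \<noteq> 0 \<and> f s = t. p s)"

definition dist_sset :: "'a sset \<Rightarrow> ('a \<Rightarrow> 'r::comm_semiring_1) sset" where
  "dist_sset Y = \<lparr>simplices = (\<lambda>n. distributions (simplices Y n)),
                  pull = (\<lambda>m n f. dist_map (pull Y m n f))\<rparr>"

end

theory Submission
  imports Defs
begin

text \<open>
  In both \<open>Y = NG\<close> and \<open>Y = \<Delta>\<^sub>U\<close>, simplices glue uniquely: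
  \<open>Y\<^sub>j = Y\<^sub>m \<times>\<^bsub>Y\<^sub>k\<^esub> Y\<^sub>n\<close> for \<open>j = m + n - k\<close>. Distributions \<open>p\<close> on \<open>Y\<^sub>m\<close> and \<open>q\<close> on \<open>Y\<^sub>n\<close> with common
  marginal \<open>r\<close> on \<open>Y\<^sub>k\<close> are composed by making them conditionally independent,
  \<open>(p \<circ>\<^sub>k q)(w) = p(S\<^sub>m w) q(T\<^sub>n w) / r(T\<^sub>k S\<^sub>m w)\<close>; as \<open>R\<close> is zero-sum-free, the numerator vanishes
  wherever \<open>r\<close> does. Back-and-forth is deduced from partial naturality, which computes the faces of
  \<open>z = p \<circ>\<^sub>k q\<close>: one gets \<open>S\<^bsub>m'\<^esub> z = p \<circ>\<^sub>k S\<^bsub>k'\<^esub> q\<close> with \<open>k' = m' + n - j\<close>, and composing with \<open>q\<close>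
  along \<open>k'\<close> cancels the factor \<open>S\<^bsub>k'\<^esub> q\<close>.
\<close>

section \<open>Finitely supported distributions\<close>

text \<open>Restricting to the support keeps the sum finite for distributions on infinite sets,
  where a plain \<open>sum\<close> would default to 0.\<close>

definition mass :: "('a \<Rightarrow> 'r::comm_semiring_1) \<Rightarrow> ('a \<Rightarrow> bool) \<Rightarrow> 'r" where
  "mass p P = (\<Sum>s | p s \<noteq> 0 \<and> P s. p s)"

lemma dist_map_eq_mass: "dist_map f p t = mass p (\<lambda>s. f s = t)"
  by (simp add: dist_map_def mass_def)

lemma mass_superset:
  assumes "finite A" "\<And>s. p s \<noteq> 0 \<Longrightarrow> P s \<Longrightarrow> s \<in> A"
  shows "mass p P = (\<Sum>s | s \<in> A \<and> P s. p s)"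
  unfolding mass_def using assms by (intro sum.mono_neutral_left) auto

lemma dist_map_nonzeroE:
  assumes "dist_map f p t \<noteq> 0"
  obtains s where "p s \<noteq> 0" "f s = t"
proof -
  obtain s where "s \<in> {s. p s \<noteq> 0 \<and> f s = t}"
    using assms unfolding dist_map_def by (rule sum.not_neutral_contains_not_neutral)
  then show ?thesis using that by blast
qed

text \<open>The support of \<open>p\<close> is partitioned by the values of \<open>f\<close>;
  regrouping the double sum is the change of variables. It yields functoriality of
  \<open>dist_map\<close> and preservation of the total mass.\<close>

lemma mass_dist_map:
  assumes "finite {s. p s \<noteq> 0}"
  shows "mass (dist_map f p) P = mass p (\<lambda>s. P (f s))"
proof -
  have "mass (dist_map f p) P = (\<Sum>t | t \<in> f ` {s. p s \<noteq> 0} \<and> P t. dist_map f p t)"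
    using assms by (intro mass_superset) (auto elim: dist_map_nonzeroE)
  also have "\<dots> = (\<Sum>t | t \<in> f ` {s. p s \<noteq> 0} \<and> P t. \<Sum>s | s \<in> {s. p s \<noteq> 0 \<and> P (f s)} \<and> f s = t. p s)"
    unfolding dist_map_def by (intro sum.cong) auto
  also have "\<dots> = (\<Sum>s | p s \<noteq> 0 \<and> P (f s). p s)"
    using assms by (intro sum.group) auto
  finally show ?thesis by (simp add: mass_def)
qed

lemma distributions_iff:
  "p \<in> distributions S \<longleftrightarrow>
    finite {s. p s \<noteq> 0} \<and> (\<forall>s. p s \<noteq> 0 \<longrightarrow> s \<in> S) \<and> mass p (\<lambda>_. True) = 1"
  by (auto simp: distributions_def mass_def)

lemma distributions_eq_0: "p \<in> distributions S \<Longrightarrow> s \<notin> S \<Longrightarrow> p s = 0"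
  by (auto simp: distributions_def)

lemma distributions_finite: "p \<in> distributions S \<Longrightarrow> finite {s. p s \<noteq> 0}"
  by (simp add: distributions_def)

lemma dist_map_closed:
  assumes "p \<in> distributions S" "\<And>s. s \<in> S \<Longrightarrow> f s \<in> T"
  shows "dist_map f p \<in> distributions T"
  unfolding distributions_iff
proof (intro conjI allI impI)
  have fin: "finite {s. p s \<noteq> 0}" using assms(1) by (rule distributions_finite)
  show "finite {t. dist_map f p t \<noteq> 0}"
    by (rule finite_subset[OF _ finite_imageI[OF fin, of f]]) (auto elim: dist_map_nonzeroE)
  show "t \<in> T" if "dist_map f p t \<noteq> 0" for t
    using that assms by (auto elim!: dist_map_nonzeroE simp: distributions_iff)
  show "mass (dist_map f p) (\<lambda>_. True) = 1"
    using assms(1) by (simp add: mass_dist_map[OF fin] distributions_iff)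
qed

text \<open>Simplicial identities hold on simplices only, not on the whole type; since
  \<open>p\<close> vanishes off \<open>S\<close>, they still pass to pushforwards.\<close>

lemma dist_map_cong:
  assumes "p \<in> distributions S" "\<And>s. s \<in> S \<Longrightarrow> f s = g s"
  shows "dist_map f p = dist_map g p"
proof
  fix t
  have "{s. p s \<noteq> 0 \<and> f s = t} = {s. p s \<noteq> 0 \<and> g s = t}"
    using assms distributions_eq_0[OF assms(1)] by metis
  then show "dist_map f p t = dist_map g p t" by (simp add: dist_map_def)
qed

lemma dist_map_ident:
  assumes "p \<in> distributions S" "\<And>s. s \<in> S \<Longrightarrow> f s = s"
  shows "dist_map f p = p"
proof -
  have "dist_map f p = dist_map (\<lambda>s. s) p" using assms by (rule dist_map_cong)
  also have "\<dots> = p"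
  proof
    fix t
    have "{s. p s \<noteq> 0 \<and> s = t} = (if p t = 0 then {} else {t})" by auto
    then show "dist_map (\<lambda>s. s) p t = p t" by (simp add: dist_map_def)
  qed
  finally show ?thesis .
qed

lemma dist_map_dist_map:
  assumes "p \<in> distributions S"
  shows "dist_map g (dist_map f p) = dist_map (\<lambda>s. g (f s)) p"
  by (rule ext) (simp only: dist_map_eq_mass mass_dist_map[OF distributions_finite[OF assms]])

section \<open>Zero-sum-freeness and division\<close>

lemma zero_sum_free_sum:
  fixes p :: "'a \<Rightarrow> 'r::zero_sum_free_semifield"
  assumes "finite A" "sum p A = 0" "a \<in> A"
  shows "p a = 0"
  using assms zero_sum_free[of "p a" "sum p (A - {a})"] sum.remove[OF assms(1,3), of p] by simp

text \<open>A nonzero \<open>p s\<close> would be a term of the finite sum defining the marginal at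
  \<open>f s\<close>, and a vanishing sum has only vanishing terms. This is what justifies dividing
  by marginals.\<close>

lemma dist_map_eq_0D:
  fixes p :: "'a \<Rightarrow> 'r::zero_sum_free_semifield"
  assumes "p \<in> distributions S" "dist_map f p (f s) = 0"
  shows "p s = 0"
proof (rule ccontr)
  assume "p s \<noteq> 0"
  then show False
    using zero_sum_free_sum[of "{s'. p s' \<noteq> 0 \<and> f s' = f s}" p s] assms
    by (auto simp: dist_map_def distributions_iff)
qed

text \<open>The value at \<open>0\<close> is unspecified.\<close>

definition semifield_inv :: "'r::semifield \<Rightarrow> 'r" where
  "semifield_inv a = (SOME b. a * b = 1)"

lemma semifield_inv: "a \<noteq> 0 \<Longrightarrow> a * semifield_inv a = 1"
  unfolding semifield_inv_def by (rule someI_ex) (rule ex_mult_inverse)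

text \<open>If \<open>a\<close> is 0, both sides vanish, so the unspecified value of
  \<open>semifield_inv\<close> at 0 does no harm.\<close>

lemma mult_semifield_inv_cancel:
  assumes "a = 0 \<Longrightarrow> p = 0"
  shows "p * a * semifield_inv a = p"
  using assms semifield_inv[of a] by (cases "a = 0") (simp_all add: mult.assoc)

section \<open>Distributions applied degreewise\<close>

lemma dist_sset_simps:
  "simplices (dist_sset Y) n = distributions (simplices Y n)"
  "pull (dist_sset Y) m n f = dist_map (pull Y m n f)"
  "initial (dist_sset Y) k n = dist_map (initial Y k n)"
  "terminal (dist_sset Y) k n = dist_map (terminal Y k n)"
  by (simp_all add: dist_sset_def initial_def terminal_def)

lemma (in simplicial_set) simplicial_set_dist_sset: "simplicial_set (dist_sset Z :: ('a \<Rightarrow> 'r::comm_semiring_1) sset)"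
proof
  fix f l m n g and p :: "'a \<Rightarrow> 'r"
  show "pull (dist_sset Z) m n f p \<in> simplices (dist_sset Z) m"
    if "f \<in> ord_maps m n" "p \<in> simplices (dist_sset Z) n"
    using that pull_closed by (auto simp: dist_sset_simps intro: dist_map_closed)
  show "pull (dist_sset Z) n n (\<lambda>i\<in>{..n}. i) p = p" if "p \<in> simplices (dist_sset Z) n"
    using that pull_id by (auto simp: dist_sset_simps intro: dist_map_ident)
  show "pull (dist_sset Z) l n (compose {..l} g f) p =
      pull (dist_sset Z) l m f (pull (dist_sset Z) m n g p)"
    if "f \<in> ord_maps l m" "g \<in> ord_maps m n" "p \<in> simplices (dist_sset Z) n"
    using that by (auto simp: dist_sset_simps dist_map_dist_map pull_compose intro!: dist_map_cong)
qed

section \<open>Initial and terminal faces\<close>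

lemma init_map_closed: "k \<le> n \<Longrightarrow> init_map k \<in> ord_maps k n"
  by (auto simp: ord_maps_def init_map_def mono_on_def)

lemma term_map_closed: "k \<le> n \<Longrightarrow> term_map k n \<in> ord_maps k n"
  by (auto simp: ord_maps_def term_map_def mono_on_def)

lemma term_map_self: "term_map n n = (\<lambda>i\<in>{..n}. i)"
  by (simp add: term_map_def)

lemma compose_init_map_init_map:
  "k \<le> m \<Longrightarrow> compose {..k} (init_map m) (init_map k) = init_map k"
  by (auto simp: compose_def init_map_def)

lemma compose_term_map_term_map:
  "k \<le> m \<Longrightarrow> m \<le> n \<Longrightarrow> compose {..k} (term_map m n) (term_map k m) = term_map k n"
  by (auto simp: compose_def term_map_def fun_eq_iff)

context simplicial_set
begin

lemma initial_closed: "k \<le> n \<Longrightarrow> x \<in> simplices Z n \<Longrightarrow> initial Z k n x \<in> simplices Z k"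
  unfolding initial_def by (intro pull_closed init_map_closed)

lemma terminal_closed: "k \<le> n \<Longrightarrow> x \<in> simplices Z n \<Longrightarrow> terminal Z k n x \<in> simplices Z k"
  unfolding terminal_def by (intro pull_closed term_map_closed)

lemma initial_self: "x \<in> simplices Z n \<Longrightarrow> initial Z n n x = x"
  using pull_id by (simp add: initial_def init_map_def)

lemma terminal_self: "x \<in> simplices Z n \<Longrightarrow> terminal Z n n x = x"
  using pull_id by (simp add: terminal_def term_map_self)

lemma initial_initial:
  "k \<le> m \<Longrightarrow> m \<le> n \<Longrightarrow> x \<in> simplices Z n \<Longrightarrow> initial Z k m (initial Z m n x) = initial Z k n x"
  unfolding initial_def
  by (simp add: pull_compose[symmetric] init_map_closed compose_init_map_init_map)

lemma terminal_terminal: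
  "k \<le> m \<Longrightarrow> m \<le> n \<Longrightarrow> x \<in> simplices Z n \<Longrightarrow> terminal Z k m (terminal Z m n x) = terminal Z k n x"
  unfolding terminal_def
  by (simp add: pull_compose[symmetric] term_map_closed compose_term_map_term_map)

text \<open>Both sides are the pullback along i -> i + (m - k), the inclusion of the overlap of the
  first m + 1 and the last n + 1 vertices of [j].\<close>

lemma terminal_initial:
  assumes "k \<le> m" "k \<le> n" "j = m + n - k" "x \<in> simplices Z j"
  shows "terminal Z k m (initial Z m j x) = initial Z k n (terminal Z n j x)"
proof -
  have "compose {..k} (init_map m) (term_map k m) = compose {..k} (term_map n j) (init_map k)"
    using assms(1-3) by (auto simp: compose_def init_map_def term_map_def fun_eq_iff)
  then show ?thesis
    using assms unfolding terminal_def initial_def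
    by (simp add: pull_compose[symmetric] term_map_closed init_map_closed)
qed

text \<open>As \<open>f\<close> matches the terminal copies of [k], pulling back along it leaves the
  overlap unchanged; this and its initial counterpart preserve k-composability.\<close>

lemma terminal_pull:
  assumes "k \<le> m'" "f \<in> ord_maps m' m" "compose {..k} f (term_map k m') = term_map k m"
    "x \<in> simplices Z m"
  shows "terminal Z k m' (pull Z m' m f x) = terminal Z k m x"
  using assms by (simp add: terminal_def pull_compose[symmetric] term_map_closed)

lemma initial_pull:
  assumes "k \<le> n'" "g \<in> ord_maps n' n" "compose {..k} g (init_map k) = init_map k"
    "y \<in> simplices Z n"
  shows "initial Z k n' (pull Z n' n g y) = initial Z k n y"
  using assms by (simp add: initial_def pull_compose[symmetric] init_map_closed)

text \<open>By contravariance, the equation between \<open>h\<close> and \<open>f\<close> becomes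
  one between faces. With its terminal counterpart it describes the pullback along \<open>h\<close>
  on both glued halves.\<close>

lemma initial_pull_glued:
  assumes "k \<le> m" "k \<le> n" "k \<le> m'" "k \<le> n'" "f \<in> ord_maps m' m"
    "h \<in> ord_maps (m' + n' - k) (m + n - k)"
    "compose {..m'} h (init_map m') = compose {..m'} (init_map m) f"
    "w \<in> simplices Z (m + n - k)"
  shows "initial Z m' (m' + n' - k) (pull Z (m' + n' - k) (m + n - k) h w) =
    pull Z m' m f (initial Z m (m + n - k) w)"
  using assms unfolding initial_def by (simp add: pull_compose[symmetric] init_map_closed)

lemma terminal_pull_glued:
  assumes "k \<le> m" "k \<le> n" "k \<le> m'" "k \<le> n'" "g \<in> ord_maps n' n"
    "h \<in> ord_maps (m' + n' - k) (m + n - k)"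
    "compose {..n'} h (term_map n' (m' + n' - k)) = compose {..n'} (term_map n (m + n - k)) g"
    "w \<in> simplices Z (m + n - k)"
  shows "terminal Z n' (m' + n' - k) (pull Z (m' + n' - k) (m + n - k) h w) =
    pull Z n' n g (terminal Z n (m + n - k) w)"
  using assms unfolding terminal_def by (simp add: pull_compose[symmetric] term_map_closed)

end

section \<open>Conditional products\<close>

text \<open>A Segal-type condition: surjectivity is existence of the glued simplex, injectivity its
  uniqueness.\<close>

locale gluing_sset = simplicial_set Y for Y :: "'a sset" +
  assumes bij_betw_glue: "k \<le> m \<Longrightarrow> k \<le> n \<Longrightarrow>
    bij_betw (\<lambda>w. (initial Y m (m + n - k) w, terminal Y n (m + n - k) w))
      (simplices Y (m + n - k)) {(x, y). composable Y m n k x y}"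

text \<open>The denominator is the marginal of \<open>p\<close> on the overlap, which composability
  identifies with that of \<open>q\<close>. The cutoff to 0 off the simplices matches the
  representation of distributions by functions on the whole type.\<close>

definition dist_comp ::
  "'a sset \<Rightarrow> nat \<Rightarrow> nat \<Rightarrow> nat \<Rightarrow> ('a \<Rightarrow> 'r::semifield) \<Rightarrow> ('a \<Rightarrow> 'r) \<Rightarrow> 'a \<Rightarrow> 'r" where
  "dist_comp Y m n k p q = (\<lambda>w. if w \<in> simplices Y (m + n - k) then
     p (initial Y m (m + n - k) w) * q (terminal Y n (m + n - k) w) *
     semifield_inv (dist_map (terminal Y k m) p (terminal Y k m (initial Y m (m + n - k) w)))
     else 0)"

text \<open>The index set on the left is in bijection with a product of two sets, so the sum of
  products factors. Existence of \<open>w\<close> is asked only where both weights are nonzero and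
  \<open>P\<close>, \<open>Q\<close> hold, because arbitrary pairs need not glue.\<close>

lemma sum_pullback_eq_mass_mult_mass:
  assumes inj: "inj_on (\<lambda>w. (a w, b w)) W"
    and surj: "\<And>x y. p x \<noteq> 0 \<Longrightarrow> q y \<noteq> 0 \<Longrightarrow> P x \<Longrightarrow> Q y \<Longrightarrow> \<exists>w\<in>W. a w = x \<and> b w = y"
  shows "(\<Sum>w | w \<in> W \<and> p (a w) \<noteq> 0 \<and> q (b w) \<noteq> 0 \<and> P (a w) \<and> Q (b w). p (a w) * q (b w)) =
    mass p P * mass q Q"
proof -
  let ?W = "{w. w \<in> W \<and> p (a w) \<noteq> 0 \<and> q (b w) \<noteq> 0 \<and> P (a w) \<and> Q (b w)}"
  have "bij_betw (\<lambda>w. (a w, b w)) ?W ({x. p x \<noteq> 0 \<and> P x} \<times> {y. q y \<noteq> 0 \<and> Q y})"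
    unfolding bij_betw_def using surj by (auto intro!: inj_on_subset[OF inj] simp: image_iff)
  from sum.reindex_bij_betw[OF this, of "\<lambda>(x, y). p x * q y"]
  show ?thesis by (simp add: mass_def sum_product sum.cartesian_product)
qed

context gluing_sset
begin

lemma glue_inj:
  assumes "k \<le> m" "k \<le> n" "w \<in> simplices Y (m + n - k)" "w' \<in> simplices Y (m + n - k)"
    "initial Y m (m + n - k) w = initial Y m (m + n - k) w'"
    "terminal Y n (m + n - k) w = terminal Y n (m + n - k) w'"
  shows "w = w'"
  using bij_betw_glue[OF assms(1,2)] assms(3-) by (auto simp: bij_betw_def dest: inj_onD)

lemma glue_surj:
  assumes "composable Y m n k x y"
  shows "\<exists>w\<in>simplices Y (m + n - k).
    initial Y m (m + n - k) w = x \<and> terminal Y n (m + n - k) w = y"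
proof -
  have "(x, y) \<in> (\<lambda>w. (initial Y m (m + n - k) w, terminal Y n (m + n - k) w)) `
      simplices Y (m + n - k)"
    using bij_betw_imp_surj_on[OF bij_betw_glue[of k m n]] assms by (auto simp: composable_def)
  then show ?thesis by auto
qed

text \<open>By uniqueness of gluing, the pair of faces embeds this set in the product of two finite
  supports.\<close>

lemma finite_support_dist_comp:
  fixes p q :: "'a \<Rightarrow> 'r::semifield"
  assumes "composable (dist_sset Y) m n k p q"
  shows "finite {w. w \<in> simplices Y (m + n - k) \<and> p (initial Y m (m + n - k) w) \<noteq> 0 \<and>
    q (terminal Y n (m + n - k) w) \<noteq> 0}" (is "finite ?A")
proof (rule finite_imageD)
  let ?F = "\<lambda>w. (initial Y m (m + n - k) w, terminal Y n (m + n - k) w)"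
  have "finite {x. p x \<noteq> 0}" "finite {y. q y \<noteq> 0}"
    using assms by (auto simp: composable_def dist_sset_simps distributions_iff)
  then have "finite ({x. p x \<noteq> 0} \<times> {y. q y \<noteq> 0})" by simp
  moreover have "?F ` ?A \<subseteq> {x. p x \<noteq> 0} \<times> {y. q y \<noteq> 0}" by auto
  ultimately show "finite (?F ` ?A)" by (rule rev_finite_subset)
  show "inj_on ?F ?A"
    using assms by (intro inj_onI, rule_tac glue_inj[of k m n]) (auto simp: composable_def)
qed

text \<open>
  The gluing property makes each fibre of \<open>h\<^sup>*\<close> a product of a fibre of \<open>f\<^sup>*\<close> and a fibre of
  \<open>g\<^sup>*\<close>, on which the denominator of the conditional product is constant.
\<close>

lemma dist_comp_natural:
  fixes p q :: "'a \<Rightarrow> 'r::zero_sum_free_semifield"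
  assumes pq: "composable (dist_sset Y) m n k p q" and k: "k \<le> m'" "k \<le> n'"
    and f: "f \<in> ord_maps m' m" and g: "g \<in> ord_maps n' n"
    and fT: "compose {..k} f (term_map k m') = term_map k m"
    and gS: "compose {..k} g (init_map k) = init_map k"
    and h: "h \<in> ord_maps (m' + n' - k) (m + n - k)"
    and hS: "compose {..m'} h (init_map m') = compose {..m'} (init_map m) f"
    and hT: "compose {..n'} h (term_map n' (m' + n' - k)) = compose {..n'} (term_map n (m + n - k)) g"
  shows "dist_comp Y m' n' k (dist_map (pull Y m' m f) p) (dist_map (pull Y n' n g) q) =
    dist_map (pull Y (m' + n' - k) (m + n - k) h) (dist_comp Y m n k p q)"
proof
  let ?j = "m + n - k" and ?j' = "m' + n' - k"
  let ?a = "initial Y m ?j" and ?b = "terminal Y n ?j" and ?c = "terminal Y k m"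
  let ?a' = "initial Y m' ?j'" and ?b' = "terminal Y n' ?j'" and ?c' = "terminal Y k m'"
  let ?h = "pull Y ?j' ?j h" and ?f = "pull Y m' m f" and ?g = "pull Y n' n g"
  have p: "p \<in> distributions (simplices Y m)" and q: "q \<in> distributions (simplices Y n)"
    and km: "k \<le> m" "k \<le> n"
    using pq by (auto simp: composable_def dist_sset_simps)
  \<comment> \<open>\<open>f\<close> preserves the terminal k-face, so both compositions have the
    same denominator.\<close>
  have r: "dist_map ?c' (dist_map ?f p) = dist_map ?c p"
    using p k f fT by (auto simp: dist_map_dist_map terminal_pull intro!: dist_map_cong)
  have ha: "?a' (?h w) = ?f (?a w)" and hb: "?b' (?h w) = ?g (?b w)" if "w \<in> simplices Y ?j" for w
    using initial_pull_glued[OF km k f h hS that] terminal_pull_glued[OF km k g h hT that] .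
  fix w'
  show "dist_comp Y m' n' k (dist_map ?f p) (dist_map ?g q) w' = dist_map ?h (dist_comp Y m n k p q) w'"
  proof (cases "w' \<in> simplices Y ?j'")
    case False
    have "dist_map ?h (dist_comp Y m n k p q) w' = 0"
    proof (rule ccontr)
      assume "dist_map ?h (dist_comp Y m n k p q) w' \<noteq> 0"
      then obtain w where "dist_comp Y m n k p q w \<noteq> 0" "?h w = w'" by (rule dist_map_nonzeroE)
      then show False using False pull_closed[OF h] by (auto simp: dist_comp_def split: if_splits)
    qed
    then show ?thesis using False by (simp add: dist_comp_def)
  next
    case True
    let ?i = "semifield_inv (dist_map ?c p (?c' (?a' w')))"
    let ?P = "\<lambda>x. ?f x = ?a' w'" and ?Q = "\<lambda>y. ?g y = ?b' w'"
    have fibre: "?h w = w' \<longleftrightarrow> ?P (?a w) \<and> ?Q (?b w)" if "w \<in> simplices Y ?j" for w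
      using ha[OF that] hb[OF that] glue_inj[OF k pull_closed[OF h that] True] by metis
    have c: "?c (?a w) = ?c' (?a' w')" if "w \<in> simplices Y ?j" "?P (?a w)" for w
      using terminal_pull[OF k(1) f fT, of "?a w"] initial_closed[of m ?j w] that km by simp
    \<comment> \<open>Indexing by the set where both factors of the numerator are nonzero prepares
      the factorization; outside it the composite is 0.\<close>
    have "dist_map ?h (dist_comp Y m n k p q) w' =
      (\<Sum>w | w \<in> {w \<in> simplices Y ?j. p (?a w) \<noteq> 0 \<and> q (?b w) \<noteq> 0} \<and> ?h w = w'.
        dist_comp Y m n k p q w)"
      unfolding dist_map_eq_mass using finite_support_dist_comp[OF pq]
      by (intro mass_superset) (auto simp: dist_comp_def split: if_splits)
    also have "\<dots> = (\<Sum>w | w \<in> simplices Y ?j \<and> p (?a w) \<noteq> 0 \<and> q (?b w) \<noteq> 0 \<and>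
        ?P (?a w) \<and> ?Q (?b w). p (?a w) * q (?b w) * ?i)"
      using fibre c by (intro sum.cong) (auto simp: dist_comp_def)
    also have "\<dots> = mass p ?P * mass q ?Q * ?i"
    proof (subst sum_distrib_right[symmetric], subst sum_pullback_eq_mass_mult_mass)
      show "inj_on (\<lambda>w. (?a w, ?b w)) (simplices Y ?j)"
        using bij_betw_glue[OF km] by (simp add: bij_betw_def)
      fix x y assume xy: "p x \<noteq> 0" "q y \<noteq> 0" "?P x" "?Q y"
      then have Y: "x \<in> simplices Y m" "y \<in> simplices Y n"
        using p q by (auto simp: distributions_iff)
      \<comment> \<open>\<open>x\<close> and \<open>y\<close> can be glued because their overlaps
        both equal the k-face shared by the two halves of \<open>w'\<close>.\<close>
      have "?c x = ?c' (?a' w')"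
        using terminal_pull[OF k(1) f fT Y(1)] xy(3) by simp
      also have "\<dots> = initial Y k n' (?b' w')" by (rule terminal_initial[OF k refl True])
      also have "\<dots> = initial Y k n y"
        using initial_pull[OF k(2) g gS Y(2)] xy(4) by simp
      finally show "\<exists>w\<in>simplices Y ?j. ?a w = x \<and> ?b w = y"
        using Y km by (intro glue_surj) (simp add: composable_def)
    qed simp
    finally show ?thesis using True by (simp add: dist_comp_def r) (simp add: dist_map_eq_mass)
  qed
qed

section \<open>The identity axioms\<close>

lemma dist_comp_identity_right:
  fixes p q :: "'a \<Rightarrow> 'r::zero_sum_free_semifield"
  assumes "composable (dist_sset Y) m n n p q"
  shows "dist_comp Y m n n p q = p"
proof
  fix x
  have p: "p \<in> distributions (simplices Y m)" and q: "q \<in> distributions (simplices Y n)"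
    and r: "dist_map (terminal Y n m) p = q"
    using assms dist_map_ident[of q "simplices Y n" "initial Y n n"] initial_self
    by (auto simp: composable_def dist_sset_simps)
  show "dist_comp Y m n n p q x = p x"
  proof (cases "x \<in> simplices Y m")
    case True
    \<comment> \<open>For k = n the overlap marginal is \<open>q\<close> itself, so the second
      factor cancels against the denominator wherever \<open>q\<close> is nonzero; elsewhere
      \<open>p\<close> vanishes.\<close>
    have "q (terminal Y n m x) = 0 \<Longrightarrow> p x = 0" using dist_map_eq_0D[OF p] r by metis
    then show ?thesis
      using True by (simp add: dist_comp_def initial_self r mult_semifield_inv_cancel)
  next
    case False
    then show ?thesis using distributions_eq_0[OF p] by (simp add: dist_comp_def)
  qed
qed

text \<open>For k = m the overlap marginal is \<open>p\<close> itself and cancels the first factor;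
  as \<open>p\<close> is also a marginal of \<open>q\<close>, zeros of the denominator are zeros of
  \<open>q\<close>.\<close>

lemma dist_comp_identity_left:
  fixes p q :: "'a \<Rightarrow> 'r::zero_sum_free_semifield"
  assumes "composable (dist_sset Y) m n m p q"
  shows "dist_comp Y m n m p q = q"
proof
  fix y
  have p: "p \<in> distributions (simplices Y m)" and q: "q \<in> distributions (simplices Y n)"
    and r: "dist_map (terminal Y m m) p = p" and r': "p = dist_map (initial Y m n) q"
    and mn: "m \<le> n"
    using assms dist_map_ident[of p "simplices Y m" "terminal Y m m"] terminal_self
    by (auto simp: composable_def dist_sset_simps)
  show "dist_comp Y m n m p q y = q y"
  proof (cases "y \<in> simplices Y n")
    case True
    have "p (initial Y m n y) = 0 \<Longrightarrow> q y = 0" using dist_map_eq_0D[OF q] r' by metis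
    moreover have "terminal Y m m (initial Y m n y) = initial Y m n y"
      using True mn by (intro terminal_self initial_closed)
    ultimately show ?thesis
      using True mult_semifield_inv_cancel[of "p (initial Y m n y)" "q y"]
      by (simp add: dist_comp_def terminal_self r mult.commute)
  next
    case False
    then show ?thesis using distributions_eq_0[OF q] by (simp add: dist_comp_def)
  qed
qed

text \<open>Partial naturality with \<open>f\<close> the identity of [m], written
  \<open>init_map m\<close>, and with \<open>g\<close> and \<open>h\<close> the initial inclusions
  of [n'] and [m + n' - k].\<close>

lemma initial_dist_comp:
  fixes p q :: "'a \<Rightarrow> 'r::zero_sum_free_semifield"
  assumes pq: "composable (dist_sset Y) m n k p q" and n': "k \<le> n'" "n' \<le> n"
  shows "dist_map (initial Y (m + n' - k) (m + n - k)) (dist_comp Y m n k p q) =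
    dist_comp Y m n' k p (dist_map (initial Y n' n) q)"
proof -
  have km: "k \<le> m" "k \<le> n" and p: "p \<in> distributions (simplices Y m)"
    using pq by (auto simp: composable_def dist_sset_simps)
  have "dist_map (pull Y m m (init_map m)) p = p"
    using p initial_self by (intro dist_map_ident) (auto simp: initial_def)
  moreover have "compose {..k} (init_map m) (term_map k m) = term_map k m"
    using km by (auto simp: compose_def init_map_def term_map_def fun_eq_iff)
  moreover have "compose {..m} (init_map (m + n' - k)) (init_map m) =
      compose {..m} (init_map m) (init_map m)"
    using n' by (auto simp: compose_def init_map_def fun_eq_iff)
  moreover have "compose {..n'} (init_map (m + n' - k)) (term_map n' (m + n' - k)) =
      compose {..n'} (term_map n (m + n - k)) (init_map n')"
    using n' km by (auto simp: compose_def init_map_def term_map_def fun_eq_iff)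
  ultimately show ?thesis
    unfolding initial_def
    using dist_comp_natural[OF pq km(1) n'(1) init_map_closed[OF order_refl] init_map_closed[OF n'(2)]
        _ compose_init_map_init_map[OF n'(1)] init_map_closed[of "m + n' - k" "m + n - k"]] n'
    by simp
qed

text \<open>Partial naturality with \<open>f\<close> and \<open>h\<close> terminal inclusions and
  \<open>g\<close> the identity of [n].\<close>

lemma terminal_dist_comp:
  fixes p q :: "'a \<Rightarrow> 'r::zero_sum_free_semifield"
  assumes pq: "composable (dist_sset Y) m n k p q" and m': "k \<le> m'" "m' \<le> m"
  shows "dist_map (terminal Y (m' + n - k) (m + n - k)) (dist_comp Y m n k p q) =
    dist_comp Y m' n k (dist_map (terminal Y m' m) p) q"
proof -
  have km: "k \<le> m" "k \<le> n" and q: "q \<in> distributions (simplices Y n)"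
    using pq by (auto simp: composable_def dist_sset_simps)
  have "dist_map (pull Y n n (init_map n)) q = q"
    using q initial_self by (intro dist_map_ident) (auto simp: initial_def)
  moreover have "compose {..m'} (term_map (m' + n - k) (m + n - k)) (init_map m') =
      compose {..m'} (init_map m) (term_map m' m)"
    using m' km by (auto simp: compose_def init_map_def term_map_def fun_eq_iff)
  moreover have "compose {..n} (term_map (m' + n - k) (m + n - k)) (term_map n (m' + n - k)) =
      compose {..n} (term_map n (m + n - k)) (init_map n)"
    using m' km by (auto simp: compose_def init_map_def term_map_def fun_eq_iff)
  ultimately show ?thesis
    unfolding terminal_def
    using dist_comp_natural[OF pq m'(1) km(2) term_map_closed[OF m'(2)] init_map_closed[OF order_refl]
        compose_term_map_term_map[OF m'] compose_init_map_init_map[OF km(2)]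
        term_map_closed[of "m' + n - k" "m + n - k"]] m'
    by simp
qed

text \<open>Taking n' = k cuts the second factor down to the overlap, where the identity axiom
  applies.\<close>

lemma initial_dist_comp_self:
  fixes p q :: "'a \<Rightarrow> 'r::zero_sum_free_semifield"
  assumes pq: "composable (dist_sset Y) m n k p q"
  shows "dist_map (initial Y m (m + n - k)) (dist_comp Y m n k p q) = p"
proof -
  interpret D: simplicial_set "dist_sset Y :: ('a \<Rightarrow> 'r) sset" by (rule simplicial_set_dist_sset)
  have "composable (dist_sset Y) m k k p (dist_map (initial Y k n) q)"
    using pq D.initial_closed[of k n q] D.initial_self[of "dist_map (initial Y k n) q" k]
    by (auto simp: composable_def dist_sset_simps)
  from dist_comp_identity_right[OF this] show ?thesis
    using initial_dist_comp[OF pq order_refl] pq by (simp add: composable_def)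
qed

lemma terminal_dist_comp_self:
  fixes p q :: "'a \<Rightarrow> 'r::zero_sum_free_semifield"
  assumes pq: "composable (dist_sset Y) m n k p q"
  shows "dist_map (terminal Y n (m + n - k)) (dist_comp Y m n k p q) = q"
proof -
  interpret D: simplicial_set "dist_sset Y :: ('a \<Rightarrow> 'r) sset" by (rule simplicial_set_dist_sset)
  have "composable (dist_sset Y) k n k (dist_map (terminal Y k m) p) q"
    using pq D.terminal_closed[of k m p] D.terminal_self[of "dist_map (terminal Y k m) p" k]
    by (auto simp: composable_def dist_sset_simps)
  from dist_comp_identity_left[OF this] show ?thesis
    using terminal_dist_comp[OF pq order_refl] pq by (simp add: composable_def)
qed

text \<open>Pushforward preserves total mass and the initial marginal of the composite is
  \<open>p\<close>, so the total is 1. That marginal comes from naturality, which does not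
  presuppose normalization, so the argument is not circular.\<close>

lemma dist_comp_closed:
  fixes p q :: "'a \<Rightarrow> 'r::zero_sum_free_semifield"
  assumes pq: "composable (dist_sset Y) m n k p q"
  shows "dist_comp Y m n k p q \<in> distributions (simplices Y (m + n - k))"
proof -
  have fin: "finite {w. dist_comp Y m n k p q w \<noteq> 0}"
    by (rule finite_subset[OF _ finite_support_dist_comp[OF pq]])
      (auto simp: dist_comp_def split: if_splits)
  have "mass (dist_comp Y m n k p q) (\<lambda>_. True) = 1"
    using mass_dist_map[OF fin, of "initial Y m (m + n - k)" "\<lambda>_. True"] pq
    by (simp add: initial_dist_comp_self[OF pq] composable_def dist_sset_simps distributions_iff)
  with fin show ?thesis by (auto simp: distributions_iff dist_comp_def split: if_splits)
qed

section \<open>Back-and-forth\<close>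

lemma dist_comp_back_and_forth_left:
  fixes p q :: "'a \<Rightarrow> 'r::zero_sum_free_semifield"
  defines "D \<equiv> dist_sset Y"
  assumes pq: "composable D m n k p q" and j: "j = m + n - k" and z: "z = dist_comp Y m n k p q"
    and m': "m \<le> m'" "m' \<le> j"
  shows "composable D m' n (m' + n - j) (initial D m' j z) q \<and>
    dist_comp Y m' n (m' + n - j) (initial D m' j z) q = z"
proof
  interpret D: simplicial_set D unfolding D_def by (rule simplicial_set_dist_sset)
  note pq' = pq[unfolded D_def]
  have km: "k \<le> m" "k \<le> n" and q: "q \<in> distributions (simplices Y n)" "q \<in> simplices D n"
    using pq by (auto simp: composable_def D_def dist_sset_simps)
  define k' where "k' = m' + n - j"
  have k': "k \<le> k'" "k' \<le> n" "k' \<le> m'" "m + k' - k = m'" "m' + n - k' = j"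
    using km m' unfolding k'_def j by auto
  have zD: "z \<in> simplices D j"
    using dist_comp_closed[OF pq'] by (simp add: z j D_def dist_sset_simps)
  define p' where "p' = initial D m' j z"
  define q' where "q' = initial D k' n q"
  have p': "p' = dist_comp Y m k' k p q'"
    using initial_dist_comp[OF pq' k'(1,2)] k'(4)
    by (simp add: p'_def q'_def z D_def dist_sset_simps j)
  \<comment> \<open>Since the terminal n-face of \<open>z\<close> is \<open>q\<close>, the marginal
    of \<open>p'\<close> on the new overlap is \<open>q'\<close>. This gives composability and
    identifies the new denominator.\<close>
  have "terminal D k' m' p' = initial D k' n (terminal D n j z)"
    unfolding p'_def using k' zD by (intro D.terminal_initial) auto
  also have "terminal D n j z = q"
    using terminal_dist_comp_self[OF pq'] by (simp add: z j D_def dist_sset_simps)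
  finally have T: "terminal D k' m' p' = q'" by (simp add: q'_def)
  show "composable D m' n (m' + n - j) (initial D m' j z) q"
    using T k' q D.initial_closed[OF m'(2) zD]
    by (simp add: composable_def k'_def[symmetric] p'_def[symmetric] q'_def)
  have "dist_comp Y m' n k' p' q w = z w" for w
  proof (cases "w \<in> simplices Y j")
    case True
    \<comment> \<open>\<open>v\<close> is the overlap in \<open>w\<close>: there \<open>q'\<close>
      is evaluated both as a factor of \<open>p'\<close> and as the denominator.\<close>
    define v where "v = terminal Y k' m' (initial Y m' j w)"
    have v: "v = initial Y k' n (terminal Y n j w)"
      unfolding v_def using k' True by (intro terminal_initial) auto
    have w': "initial Y m' j w \<in> simplices Y m'" using True m' by (intro initial_closed)
    have a: "initial Y m m' (initial Y m' j w) = initial Y m j w"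
      using True m' by (intro initial_initial)
    \<comment> \<open>\<open>q'\<close> is a marginal of \<open>q\<close>, so cancelling it is
      legitimate even where it vanishes.\<close>
    have "q' v = 0 \<Longrightarrow> q (terminal Y n j w) = 0"
      using dist_map_eq_0D[OF q(1)] by (simp add: q'_def v D_def dist_sset_simps)
    then have cancel: "q (terminal Y n j w) * q' v * semifield_inv (q' v) = q (terminal Y n j w)"
      by (rule mult_semifield_inv_cancel)
    have "dist_comp Y m' n k' p' q w =
        p' (initial Y m' j w) * q (terminal Y n j w) * semifield_inv (q' v)"
      using True T k'(5) by (simp add: dist_comp_def v_def D_def dist_sset_simps)
    moreover have "p' (initial Y m' j w) = p (initial Y m j w) * q' v *
        semifield_inv (dist_map (terminal Y k m) p (terminal Y k m (initial Y m j w)))"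
      using w' k'(4) by (simp add: p' dist_comp_def a v_def)
    ultimately have "dist_comp Y m' n k' p' q w =
        p (initial Y m j w) * (q (terminal Y n j w) * q' v * semifield_inv (q' v)) *
        semifield_inv (dist_map (terminal Y k m) p (terminal Y k m (initial Y m j w)))"
      by (simp only: mult_ac)
    also have "\<dots> = z w"
      unfolding cancel using True by (simp add: z dist_comp_def j mult_ac)
    finally show ?thesis .
  next
    case False
    then show ?thesis using k'(5) by (simp add: z dist_comp_def j)
  qed
  then show "dist_comp Y m' n (m' + n - j) (initial D m' j z) q = z"
    by (auto simp: k'_def p'_def)
qed

text \<open>The mirror image: the terminal face of \<open>z\<close> is the composite of
  \<open>p'\<close> and \<open>q\<close>, and composing it with \<open>p\<close> along k' cancels
  \<open>p'\<close>.\<close>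

lemma dist_comp_back_and_forth_right:
  fixes p q :: "'a \<Rightarrow> 'r::zero_sum_free_semifield"
  defines "D \<equiv> dist_sset Y"
  assumes pq: "composable D m n k p q" and j: "j = m + n - k" and z: "z = dist_comp Y m n k p q"
    and n': "n \<le> n'" "n' \<le> j"
  shows "composable D m n' (m + n' - j) p (terminal D n' j z) \<and>
    dist_comp Y m n' (m + n' - j) p (terminal D n' j z) = z"
proof
  interpret D: simplicial_set D unfolding D_def by (rule simplicial_set_dist_sset)
  note pq' = pq[unfolded D_def]
  have km: "k \<le> m" "k \<le> n" and p: "p \<in> distributions (simplices Y m)" "p \<in> simplices D m"
    using pq by (auto simp: composable_def D_def dist_sset_simps)
  define k' where "k' = m + n' - j"
  have k': "k \<le> k'" "k' \<le> m" "k' \<le> n'" "k' + n - k = n'" "m + n' - k' = j"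
    using km n' unfolding k'_def j by auto
  have zD: "z \<in> simplices D j"
    using dist_comp_closed[OF pq'] by (simp add: z j D_def dist_sset_simps)
  define q' where "q' = terminal D n' j z"
  define p' where "p' = terminal D k' m p"
  have q': "q' = dist_comp Y k' n k p' q"
    using terminal_dist_comp[OF pq' k'(1,2)] k'(4)
    by (simp add: p'_def q'_def z D_def dist_sset_simps j)
  have "initial D k' n' q' = terminal D k' m (initial D m j z)"
    unfolding q'_def using k' zD by (intro D.terminal_initial[symmetric]) auto
  also have "initial D m j z = p"
    using initial_dist_comp_self[OF pq'] by (simp add: z j D_def dist_sset_simps)
  finally have T: "initial D k' n' q' = p'" by (simp add: p'_def)
  show "composable D m n' (m + n' - j) p (terminal D n' j z)"
    using T k' p D.terminal_closed[OF n'(2) zD]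
    by (simp add: composable_def k'_def[symmetric] q'_def[symmetric] p'_def)
  have p'_eq: "p' = dist_map (terminal Y k' m) p" by (simp add: p'_def D_def dist_sset_simps)
  \<comment> \<open>The inner composite \<open>q'\<close> divides by a marginal of
    \<open>p'\<close>, the original one by a marginal of \<open>p\<close>; the two marginals
    coincide.\<close>
  have "terminal D k k' p' = terminal D k m p"
    unfolding p'_def using k' p(2) by (intro D.terminal_terminal)
  then have r: "dist_map (terminal Y k k') p' = dist_map (terminal Y k m) p"
    by (simp add: D_def dist_sset_simps)
  have "dist_comp Y m n' k' p q' w = z w" for w
  proof (cases "w \<in> simplices Y j")
    case True
    define v where "v = terminal Y k' m (initial Y m j w)"
    have v: "v = initial Y k' n' (terminal Y n' j w)"
      unfolding v_def using k' True by (intro terminal_initial) auto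
    have mj: "m \<le> j" using km j by simp
    have w': "terminal Y n' j w \<in> simplices Y n'" using True n' by (intro terminal_closed)
    have b: "terminal Y n n' (terminal Y n' j w) = terminal Y n j w"
      using True n' by (intro terminal_terminal)
    have c: "terminal Y k k' v = terminal Y k m (initial Y m j w)"
      unfolding v_def using True k' mj by (intro terminal_terminal initial_closed)
    have "p' v = 0 \<Longrightarrow> p (initial Y m j w) = 0"
      using dist_map_eq_0D[OF p(1)] by (simp add: p'_eq v_def)
    then have cancel: "p (initial Y m j w) * p' v * semifield_inv (p' v) = p (initial Y m j w)"
      by (rule mult_semifield_inv_cancel)
    have "dist_comp Y m n' k' p q' w =
        p (initial Y m j w) * q' (terminal Y n' j w) * semifield_inv (p' v)"
      using True k'(5) by (simp add: dist_comp_def v_def p'_eq)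
    moreover have "q' (terminal Y n' j w) = p' v * q (terminal Y n j w) *
        semifield_inv (dist_map (terminal Y k m) p (terminal Y k m (initial Y m j w)))"
      using w' k'(4) by (simp add: q' dist_comp_def b r c v[symmetric])
    ultimately have "dist_comp Y m n' k' p q' w =
        q (terminal Y n j w) * (p (initial Y m j w) * p' v * semifield_inv (p' v)) *
        semifield_inv (dist_map (terminal Y k m) p (terminal Y k m (initial Y m j w)))"
      by (simp only: mult_ac)
    also have "\<dots> = z w"
      unfolding cancel using True by (simp add: z dist_comp_def j mult_ac)
    finally show ?thesis .
  next
    case False
    then show ?thesis using k'(5) by (simp add: z dist_comp_def j)
  qed
  then show "dist_comp Y m n' (m + n' - j) p (terminal D n' j z) = z"
    by (auto simp: k'_def q'_def)
qed

section \<open>Assembling the axioms\<close>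

theorem compository_dist_sset:
  "compository (dist_sset Y :: ('a \<Rightarrow> 'r::zero_sum_free_semifield) sset) (dist_comp Y)"
proof (intro compository.intro simplicial_set_dist_sset compository_axioms.intro)
  fix m n k and p q :: "'a \<Rightarrow> 'r"
  assume pq: "composable (dist_sset Y) m n k p q"
  show "dist_comp Y m n k p q \<in> simplices (dist_sset Y) (m + n - k)"
    using dist_comp_closed[OF pq] by (simp add: dist_sset_simps)
next
  fix m n k m' n' f g h and p q :: "'a \<Rightarrow> 'r"
  assume "composable (dist_sset Y) m n k p q" "k \<le> m'" "k \<le> n'"
    "f \<in> ord_maps m' m" "g \<in> ord_maps n' n"
    "compose {..k} f (term_map k m') = term_map k m"
    "compose {..k} g (init_map k) = init_map k"
    "h \<in> ord_maps (m' + n' - k) (m + n - k)"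
    "compose {..m'} h (init_map m') = compose {..m'} (init_map m) f"
    "compose {..n'} h (term_map n' (m' + n' - k)) = compose {..n'} (term_map n (m + n - k)) g"
  then show "dist_comp Y m' n' k (pull (dist_sset Y) m' m f p) (pull (dist_sset Y) n' n g q) =
      pull (dist_sset Y) (m' + n' - k) (m + n - k) h (dist_comp Y m n k p q)"
    unfolding dist_sset_simps by (rule dist_comp_natural)
qed (simp_all only: dist_comp_identity_right dist_comp_identity_left
  dist_comp_back_and_forth_left dist_comp_back_and_forth_right simp_thms)

end

section \<open>Gluing of lists\<close>

text \<open>The offset \<open>c\<close> is \<open>0\<close> for nerves and \<open>1\<close> for \<open>\<Delta>\<^sub>U\<close>.\<close>

lemma gluing_sset_lists:
  fixes Y :: "'a list sset"
  assumes "simplicial_set Y"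
    and simplices: "\<And>n. simplices Y n = {us. length us = n + c \<and> set us \<subseteq> A}"
    and initial: "\<And>k n us. k \<le> n \<Longrightarrow> us \<in> simplices Y n \<Longrightarrow> initial Y k n us = take (k + c) us"
    and terminal: "\<And>k n us. k \<le> n \<Longrightarrow> us \<in> simplices Y n \<Longrightarrow> terminal Y k n us = drop (n - k) us"
  shows "gluing_sset Y"
proof (intro gluing_sset.intro gluing_sset_axioms.intro)
  interpret simplicial_set Y by fact
  show "simplicial_set Y" by fact
  fix k m n :: nat assume km: "k \<le> m" "k \<le> n"
  let ?j = "m + n - k"
  \<comment> \<open>A k-simplex has k + c entries, so this is the overlap: keep \<open>x\<close> and
    append what remains of \<open>y\<close> after it.\<close>
  let ?glue = "\<lambda>(x, y). x @ drop (k + c) y"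
  have w: "initial Y m ?j w = take (m + c) w" "terminal Y n ?j w = drop (m - k) w"
    if "w \<in> simplices Y ?j" for w
    using that km by (simp_all add: initial terminal)
  show "bij_betw (\<lambda>w. (initial Y m ?j w, terminal Y n ?j w)) (simplices Y ?j)
      {(x, y). composable Y m n k x y}"
  proof (rule bij_betw_byWitness[where f' = ?glue])
    have "drop (k + c) (drop (m - k) u) = drop (m + c) u" for u :: "'a list"
      using km by (simp add: add.commute)
    then show "\<forall>u\<in>simplices Y ?j. ?glue (initial Y m ?j u, terminal Y n ?j u) = u"
      by (auto simp: w simp del: drop_drop)
    have comp: "?glue (x, y) \<in> simplices Y ?j \<and> take (m + c) (?glue (x, y)) = x \<and>
      drop (m - k) (?glue (x, y)) = y" if "composable Y m n k x y" for x y
    proof -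
      have xy: "x \<in> simplices Y m" "y \<in> simplices Y n" "drop (m - k) x = take (k + c) y"
        using that km by (auto simp: composable_def initial terminal)
      have "drop (m - k) (x @ drop (k + c) y) = drop (m - k) x @ drop (k + c) y"
        using xy(1) by (simp add: simplices)
      also have "\<dots> = y" by (simp add: xy(3))
      finally show ?thesis
        using xy(1,2) km set_drop_subset[of "k + c" y] by (auto simp: simplices)
    qed
    then show "\<forall>u\<in>{(x, y). composable Y m n k x y}.
        (initial Y m ?j (?glue u), terminal Y n ?j (?glue u)) = u"
      using w by fastforce
    show "?glue ` {(x, y). composable Y m n k x y} \<subseteq> simplices Y ?j"
      using comp by auto
    have "composable Y m n k (initial Y m ?j u) (terminal Y n ?j u)" if "u \<in> simplices Y ?j" for u
      unfolding composable_def using km that terminal_initial[OF km refl that]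
      by (auto intro: initial_closed terminal_closed)
    then show "(\<lambda>w. (initial Y m ?j w, terminal Y n ?j w)) ` simplices Y ?j
        \<subseteq> {(x, y). composable Y m n k x y}" by auto
  qed
qed

section \<open>Vertex lists\<close>

lemma ord_maps_le: "f \<in> ord_maps m n \<Longrightarrow> i \<le> m \<Longrightarrow> f i \<le> n"
  by (auto simp: ord_maps_def)

lemma ord_maps_mono: "f \<in> ord_maps m n \<Longrightarrow> i \<le> i' \<Longrightarrow> i' \<le> m \<Longrightarrow> f i \<le> f i'"
  by (auto simp: ord_maps_def intro: mono_onD)

text \<open>Pullback reindexes the list of vertices, so functoriality is composition of index maps,
  and the k-faces in question are the prefix and the suffix of length k + 1.\<close>

lemma gluing_sset_Delta: "gluing_sset (Delta U)"
proof (rule gluing_sset_lists[where c = 1 and A = U])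
  show "simplicial_set (Delta U)"
  proof
    fix f g :: "nat \<Rightarrow> nat" and l m n us
    show "pull (Delta U) m n f us \<in> simplices (Delta U) m"
      if "f \<in> ord_maps m n" "us \<in> simplices (Delta U) n"
    proof -
      have "us ! f i \<in> U" if "i \<le> m" for i
        using ord_maps_le[OF \<open>f \<in> _\<close> that] \<open>us \<in> _\<close> nth_mem[of "f i" us]
        by (auto simp: Delta_def)
      then show ?thesis by (auto simp: Delta_def simp del: upt_Suc)
    qed
    show "pull (Delta U) n n (\<lambda>i\<in>{..n}. i) us = us" if "us \<in> simplices (Delta U) n"
      using that by (intro nth_equalityI) (auto simp: Delta_def simp del: upt_Suc)
    show "pull (Delta U) l n (compose {..l} g f) us = pull (Delta U) l m f (pull (Delta U) m n g us)"
      if "f \<in> ord_maps l m"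
    proof -
      have "f i < Suc m" if "i < Suc l" for i
        using ord_maps_le[OF \<open>f \<in> _\<close>, of i] that by simp
      then show ?thesis
        by (intro nth_equalityI) (auto simp: Delta_def compose_def simp del: upt_Suc)
    qed
  qed
  fix k n us
  assume kn: "k \<le> n" "us \<in> simplices (Delta U) n"
  show "initial (Delta U) k n us = take (k + 1) us"
    using kn by (intro nth_equalityI)
      (auto simp: Delta_def initial_def init_map_def simp del: upt_Suc)
  show "terminal (Delta U) k n us = drop (n - k) us"
    using kn by (intro nth_equalityI)
      (auto simp: Delta_def terminal_def term_map_def add.commute simp del: upt_Suc)
qed (auto simp: Delta_def)

section \<open>Edge lists\<close>

context monoid
begin

lemma foldr_mult_closed: "set xs \<subseteq> carrier G \<Longrightarrow> foldr (\<otimes>) xs \<one> \<in> carrier G"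
  by (induction xs) auto

lemma foldr_mult_append:
  "set xs \<subseteq> carrier G \<Longrightarrow> set ys \<subseteq> carrier G \<Longrightarrow>
    foldr (\<otimes>) (xs @ ys) \<one> = foldr (\<otimes>) xs \<one> \<otimes> foldr (\<otimes>) ys \<one>"
  by (induction xs) (auto simp: foldr_mult_closed m_assoc)

text \<open>By monotonicity the intervals from \<open>g i\<close> to \<open>g (Suc i)\<close> tile
  the one from \<open>g a\<close> to \<open>g b\<close>, and associativity merges the block
  products; an empty block contributes the unit. This is the functoriality of the nerve.\<close>

lemma foldr_mult_telescope:
  assumes "\<And>i. i < n \<Longrightarrow> x i \<in> carrier G"
    and "a \<le> b" and "\<And>i i'. i \<le> i' \<Longrightarrow> i' \<le> b \<Longrightarrow> g i \<le> g i'" and "g b \<le> n"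
  shows "foldr (\<otimes>) (map (\<lambda>i. foldr (\<otimes>) (map x [g i..<g (Suc i)]) \<one>) [a..<b]) \<one> =
    foldr (\<otimes>) (map x [g a..<g b]) \<one>"
  using assms(2-)
proof (induction b rule: dec_induct)
  case base
  then show ?case by simp
next
  case (step b)
  have g: "g a \<le> g b" "g b \<le> g (Suc b)" using step by auto
  have IH: "foldr (\<otimes>) (map (\<lambda>i. foldr (\<otimes>) (map x [g i..<g (Suc i)]) \<one>) [a..<b]) \<one> =
      foldr (\<otimes>) (map x [g a..<g b]) \<one>"
    using step.IH step.prems g(2) by simp
  have x: "set (map x [i..<i']) \<subseteq> carrier G" if "i' \<le> g (Suc b)" for i i'
    using that assms(1) step.prems(2) by auto
  have x': "set (map (\<lambda>i. foldr (\<otimes>) (map x [g i..<g (Suc i)]) \<one>) [a..<b]) \<subseteq> carrier G"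
    using x step.prems(1) by (auto intro!: foldr_mult_closed[OF x])
  have "foldr (\<otimes>) (map (\<lambda>i. foldr (\<otimes>) (map x [g i..<g (Suc i)]) \<one>) [a..<Suc b]) \<one> =
      foldr (\<otimes>) (map x [g a..<g b]) \<one> \<otimes> foldr (\<otimes>) (map x [g b..<g (Suc b)]) \<one>"
    using IH x' foldr_mult_closed[OF x[of "g (Suc b)" "g b"]] step.hyps(1)
    by (simp add: foldr_mult_append del: foldr_append)
  also have "\<dots> = foldr (\<otimes>) (map x [g a..<g b] @ map x [g b..<g (Suc b)]) \<one>"
    using x g by (intro foldr_mult_append[symmetric]) auto
  also have "map x [g a..<g b] @ map x [g b..<g (Suc b)] = map x [g a..<g (Suc b)]"
    using g upt_add_eq_append[of "g a" "g b" "g (Suc b) - g b"] by simp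
  finally show ?case .
qed

text \<open>Along \<open>init_map\<close> and \<open>term_map\<close> every block consists of a
  single edge, so its product is that edge and the faces are a prefix and a suffix of length
  k.\<close>

lemma gluing_sset_nerve: "gluing_sset (nerve G)"
proof (rule gluing_sset_lists[where c = 0 and A = "carrier G"])
  show "simplicial_set (nerve G)"
  proof
    fix f g :: "nat \<Rightarrow> nat" and l m n xs
    show "pull (nerve G) m n f xs \<in> simplices (nerve G) m"
      if f: "f \<in> ord_maps m n" and xs: "xs \<in> simplices (nerve G) n"
    proof -
      have "foldr (\<otimes>) (map ((!) xs) [f i..<f (Suc i)]) \<one> \<in> carrier G" if "i < m" for i
        using ord_maps_le[OF f, of "Suc i"] that xs
        by (intro foldr_mult_closed) (auto simp: nerve_def subset_iff)
      then show ?thesis by (auto simp: nerve_def)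
    qed
    show "pull (nerve G) n n (\<lambda>i\<in>{..n}. i) xs = xs" if "xs \<in> simplices (nerve G) n"
      using that by (intro nth_equalityI) (auto simp: nerve_def subset_iff)
    show "pull (nerve G) l n (compose {..l} g f) xs = pull (nerve G) l m f (pull (nerve G) m n g xs)"
      if f: "f \<in> ord_maps l m" and g: "g \<in> ord_maps m n" and xs: "xs \<in> simplices (nerve G) n"
    proof (rule nth_equalityI)
      fix i assume "i < length (pull (nerve G) l n (compose {..l} g f) xs)"
      then have i: "i < l" by (simp add: nerve_def)
      have fm: "f i \<le> f (Suc i)" "f (Suc i) \<le> m"
        using i ord_maps_mono[OF f, of i "Suc i"] ord_maps_le[OF f, of "Suc i"] by auto
      let ?ys = "map (\<lambda>i. foldr (\<otimes>) (map ((!) xs) [g i..<g (Suc i)]) \<one>) [0..<m]"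
      \<comment> \<open>The left side is the entry obtained along the composite map; the right side
        multiplies first along \<open>g\<close>, then along \<open>f\<close>.\<close>
      have "foldr (\<otimes>) (map ((!) xs) [g (f i)..<g (f (Suc i))]) \<one> =
        foldr (\<otimes>) (map (\<lambda>i. foldr (\<otimes>) (map ((!) xs) [g i..<g (Suc i)]) \<one>)
          [f i..<f (Suc i)]) \<one>"
        using xs fm g
        by (intro foldr_mult_telescope[where n = n, symmetric])
          (auto simp: nerve_def subset_iff intro: ord_maps_mono ord_maps_le)
      also have "map (\<lambda>i. foldr (\<otimes>) (map ((!) xs) [g i..<g (Suc i)]) \<one>) [f i..<f (Suc i)] =
        map ((!) ?ys) [f i..<f (Suc i)]"
        using fm by (intro map_cong) auto
      finally show "pull (nerve G) l n (compose {..l} g f) xs ! i =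
          pull (nerve G) l m f (pull (nerve G) m n g xs) ! i"
        using i by (simp add: nerve_def compose_def)
    qed (simp add: nerve_def)
  qed
  fix k n xs
  assume kn: "k \<le> n" "xs \<in> simplices (nerve G) n"
  show "initial (nerve G) k n xs = take (k + 0) xs"
    using kn by (intro nth_equalityI) (auto simp: nerve_def initial_def init_map_def subset_iff)
  show "terminal (nerve G) k n xs = drop (n - k) xs"
    using kn by (intro nth_equalityI)
      (auto simp: nerve_def terminal_def term_map_def subset_iff Suc_diff_le add.commute)
qed (auto simp: nerve_def)

end

theorem corollary3p32:
  fixes G :: "('g, 'b) monoid_scheme"
  assumes "group G" and "finite (carrier G)"
  shows "(\<exists>comp. compository (dist_sset (nerve G)
             :: ('g list \<Rightarrow> 'r::zero_sum_free_semifield) sset) comp) \<and>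
         (\<exists>comp. compository (dist_sset (Delta (carrier G))
             :: ('g list \<Rightarrow> 'r::zero_sum_free_semifield) sset) comp)"
proof -
  interpret group G by fact
  \<comment> \<open>The witness is \<open>dist_comp\<close> in both cases.\<close>
  show ?thesis
    using gluing_sset.compository_dist_sset[OF gluing_sset_nerve]
      gluing_sset.compository_dist_sset[OF gluing_sset_Delta] by blast
qed

end
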